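(* Let $N\ge1$ and let $Q=\prod_{i=1}^N[\ell_i,u_i]\subset[0,\infty)^N$ be an axis-aligned box not containing the origin, where $0\le\ell_i\le u_i$ and $u_i=\infty$ is allowed (with $[\ell_i,\infty)$ understood in that case). Put $x_i^0=\ell_i$ and $x_i^1=u_i$. Then $$\int_Q\frac{dx}{(x_1+\cdots+x_N)^{N+1}}=\frac1{N!}\sum_{\epsilon\in\{0,1\}^N}(-1)^{|\epsilon|}\frac{1}{x_1^{\epsilon_1}+\cdots+x_N^{\epsilon_N}},$$ where terms with an infinite coordinate are interpreted as zero.
   Context: $|\epsilon|=\epsilon_1+\cdots+\epsilon_N$ for $\epsilon\in\{0,1\}^N$. *)

theory Defs
  imports "HOL-Analysis.Analysis"
begin

definition box_between :: "('n \<Rightarrow> real) \<Rightarrow> ('n \<Rightarrow> ereal) \<Rightarrow> (real ^ 'n::finite) set" where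
  "box_between l u = {x. \<forall>i. l i \<le> x $ i \<and> ereal (x $ i) \<le> u i}"

definition corner :: "('n \<Rightarrow> real) \<Rightarrow> ('n \<Rightarrow> ereal) \<Rightarrow> ('n \<Rightarrow> nat) \<Rightarrow> 'n \<Rightarrow> ereal" where
  "corner l u \<epsilon> i = (if \<epsilon> i = 0 then ereal (l i) else u i)"

definition inverse_coord_sum :: "('n::finite \<Rightarrow> ereal) \<Rightarrow> real" where
  "inverse_coord_sum x =
     (if \<exists>i. x i = \<infinity> then 0 else 1 / (\<Sum>i\<in>UNIV. real_of_ereal (x i)))"

end

(* Since s^(-N-1) is the integral of t^N exp(-st) / N! over t > 0, exchanging the two integrals
   turns the integral over the box into the integral over t of a product of N one-dimensional
   integrals. The i-th factor is (exp(-t l_i) - exp(-t u_i)) / t, so the powers of t cancel, and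
   expanding the product leaves exponentials exp(-t S), whose integrals are 1/S. *)
theory Submission imports Defs "HOL-Probability.Distributions" begin

text \<open>The Gamma integral, read off from the \<open>k\<close>-th moment of the exponential
  density \<open>erlang_density 0 s\<close>. The case \<open>k = CARD('n)\<close> represents the
  integrand, the case \<open>k = 0\<close> integrates the final exponentials.\<close>

lemma nn_integral_power_exp:
  fixes s :: real
  assumes s: "0 < s"
  shows "(\<integral>\<^sup>+t. ennreal (t ^ k * exp (- (s * t))) * indicator {0<..} t \<partial>lborel)
         = ennreal (fact k / s ^ Suc k)"
proof -
  have "(\<integral>\<^sup>+t. ennreal (t ^ k * exp (- (s * t))) * indicator {0<..} t \<partial>lborel)
      = (\<integral>\<^sup>+t. ennreal (1 / s) * ennreal (erlang_density 0 s t * t ^ k) \<partial>lborel)"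
  proof (rule nn_integral_cong_AE)
    show "AE t in lborel. ennreal (t ^ k * exp (- (s * t))) * indicator {0<..} t
        = ennreal (1 / s) * ennreal (erlang_density 0 s t * t ^ k)"
      \<comment> \<open>The density is supported on the closed half-line, the indicator on the open
        one, so for \<open>k = 0\<close> the two sides differ at \<open>t = 0\<close>.\<close>
      using AE_lborel_singleton[of 0]
    proof eventually_elim
      case (elim t)
      then show ?case
        using s by (auto simp: erlang_density_def ennreal_mult'[symmetric] indicator_def)
    qed
  qed
  also have "\<dots> = ennreal (1 / s) * (\<integral>\<^sup>+t. ennreal (erlang_density 0 s t * t ^ k) \<partial>lborel)"
    by (intro nn_integral_cmult) auto
  also have "\<dots> = ennreal (fact k / s ^ Suc k)"
    using s by (simp add: nn_integral_erlang_ith_moment ennreal_mult'[symmetric])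
  finally show ?thesis .
qed

text \<open>The infinite case is the limit of the exponential for \<open>t > 0\<close>. It needs its
  own branch, since \<open>real_of_ereal \<infinity> = 0\<close> would produce the value 1.\<close>

definition exp_decay :: "real \<Rightarrow> ereal \<Rightarrow> real" where
  "exp_decay t a = (if a = \<infinity> then 0 else exp (- (t * real_of_ereal a)))"

lemma exp_decay_ereal [simp]: "exp_decay t (ereal a) = exp (- (t * a))"
  by (simp add: exp_decay_def)

lemma exp_decay_antimono:
  assumes "0 < t" "ereal a \<le> b"
  shows "exp_decay t b \<le> exp_decay t (ereal a)"
  using assms by (cases b) (auto simp: exp_decay_def)

text \<open>The fundamental theorem of calculus for \<open>- exp (- (t * x)) / t\<close>, which
  tends to 0 at infinity because \<open>t > 0\<close>; this limit is the \<open>exp_decay\<close>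
  value at an infinite endpoint.\<close>

lemma nn_integral_exp_interval:
  assumes t: "0 < t" and ab: "ereal a \<le> b"
  shows "(\<integral>\<^sup>+x. ennreal (exp (- (t * x))) * indicator {x. a \<le> x \<and> ereal x \<le> b} x \<partial>lborel)
         = ennreal ((exp_decay t (ereal a) - exp_decay t b) / t)"
proof -
  let ?F = "\<lambda>x. - exp (- (t * x)) / t"
  have deriv: "(?F has_real_derivative exp (- (t * x))) (at x)" for x
    using t by (auto intro!: derivative_eq_intros)
  show ?thesis
  proof (cases b)
    case (real r)
    have "(\<integral>\<^sup>+x. ennreal (exp (- (t * x))) * indicator {a..r} x \<partial>lborel) = ennreal (?F r - ?F a)"
      using ab real deriv by (intro nn_integral_FTC_Icc) (auto intro: has_field_derivative_at_within)
    moreover have "{x. a \<le> x \<and> ereal x \<le> b} = {a..r}"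
      using real by auto
    ultimately show ?thesis
      using real by (simp add: diff_divide_distrib)
  next
    case PInf
    have "(\<integral>\<^sup>+x. ennreal (exp (- (t * x))) * indicator {a..} x \<partial>lborel) = ennreal (0 - ?F a)"
    proof (rule nn_integral_FTC_atLeast)
      have "filterlim (\<lambda>x. t * x) at_top at_top"
        using t by (intro filterlim_tendsto_pos_mult_at_top[OF tendsto_const] filterlim_ident)
      then have "((\<lambda>x. exp (- (t * x))) \<longlongrightarrow> 0) at_top"
        by (intro filterlim_compose[OF exp_at_bot] filterlim_compose[OF filterlim_uminus_at_bot_at_top])
      from tendsto_divide[OF tendsto_minus[OF this] tendsto_const, of t]
      show "(?F \<longlongrightarrow> 0) at_top"
        using t by simp
    qed (use deriv in auto)
    moreover have "{x. a \<le> x \<and> ereal x \<le> b} = {a..}"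
      using PInf by auto
    ultimately show ?thesis
      using PInf by (simp add: exp_decay_def)
  qed (use ab in auto)
qed

text \<open>The product formula over \<open>Basis\<close> is reindexed along the bijection from
  coordinates to basis vectors \<open>axis i 1\<close>.\<close>

lemma nn_integral_lborel_prod_vec:
  fixes f :: "'n::finite \<Rightarrow> real \<Rightarrow> ennreal"
  assumes "\<And>i. f i \<in> borel_measurable borel"
  shows "(\<integral>\<^sup>+x. (\<Prod>i\<in>UNIV. f i (x $ i)) \<partial>(lborel :: (real ^ 'n) measure))
         = (\<Prod>i\<in>UNIV. \<integral>\<^sup>+x. f i x \<partial>lborel)"
proof -
  define e :: "'n \<Rightarrow> real ^ 'n" where "e = (\<lambda>i. axis i 1)"
  have inj: "inj e"
    by (auto simp: e_def inj_def axis_eq_axis)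
  have B: "(Basis :: (real ^ 'n) set) = range e"
    by (auto simp: Basis_vec_def e_def)
  have [simp]: "inv e (e i) = i" for i
    by (rule inv_f_f[OF inj])
  have "(\<integral>\<^sup>+x. (\<Prod>b\<in>Basis. f (inv e b) (x \<bullet> b)) \<partial>(lborel :: (real ^ 'n) measure))
        = (\<Prod>b\<in>(Basis :: (real ^ 'n) set). \<integral>\<^sup>+x. f (inv e b) x \<partial>lborel)"
    using assms by (intro nn_integral_lborel_prod) auto
  then show ?thesis
    unfolding B by (simp add: prod.reindex[OF inj] o_def) (simp add: e_def inner_axis)
qed

text \<open>An infinite coordinate makes one factor zero, in agreement with the convention for
  \<open>inverse_coord_sum\<close>. Otherwise the product is a single exponential whose rate is the
  coordinate sum, positive because one coordinate is.\<close>

lemma has_bochner_integral_prod_exp_decay: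
  fixes c :: "'n::finite \<Rightarrow> ereal"
  assumes nonneg: "\<And>i. 0 \<le> c i"
    and pos: "\<exists>i. 0 < c i"
  shows "has_bochner_integral lborel (\<lambda>t. indicator {0<..} t * (\<Prod>i\<in>UNIV. exp_decay t (c i)))
           (inverse_coord_sum c)"
proof (cases "\<exists>i. c i = \<infinity>")
  case True
  then have [simp]: "(\<Prod>i\<in>UNIV. exp_decay t (c i)) = 0" for t
    by (auto simp: exp_decay_def)
  with True show ?thesis
    by (simp add: inverse_coord_sum_def has_bochner_integral_zero)
next
  case False
  define s where "s = (\<Sum>i\<in>UNIV. real_of_ereal (c i))"
  obtain j where j: "0 < c j"
    using pos by blast
  have s: "0 < s"
    unfolding s_def
  proof (rule sum_pos2[where i = j])
    show "0 < real_of_ereal (c j)"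
      using j False by (cases "c j") auto
    show "0 \<le> real_of_ereal (c i)" for i
      using nonneg[of i] by (simp add: real_of_ereal_pos)
  qed auto
  have "(\<Prod>i\<in>UNIV. exp_decay t (c i)) = exp (- (s * t))" for t
    using False by (simp add: exp_decay_def s_def exp_sum[symmetric] sum_negf
        sum_distrib_left[symmetric] mult.commute)
  moreover have "has_bochner_integral lborel (\<lambda>t. indicator {0<..} t * exp (- (s * t))) (1 / s)"
    using nn_integral_power_exp[OF s, of 0] s
    by (intro has_bochner_integral_nn_integral)
      (auto simp: ennreal_mult' ennreal_indicator mult.commute)
  ultimately show ?thesis
    using False by (simp add: inverse_coord_sum_def s_def)
qed

text \<open>Each difference is a signed sum over the choices 0 and 1; distributing the product over
  these sums makes the exponents of the signs add up.\<close>

lemma prod_diff_expand: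
  fixes a b :: "'n::finite \<Rightarrow> 'a::comm_ring_1"
  shows "(\<Prod>i\<in>UNIV. a i - b i) =
    (\<Sum>\<epsilon> \<in> {\<epsilon> :: 'n \<Rightarrow> nat. \<forall>i. \<epsilon> i \<in> {0, 1}}.
       (- 1) ^ (\<Sum>i\<in>UNIV. \<epsilon> i) * (\<Prod>i\<in>UNIV. if \<epsilon> i = 0 then a i else b i))"
proof -
  have "(\<Prod>i\<in>UNIV. a i - b i)
      = (\<Prod>i\<in>UNIV. \<Sum>k\<in>{0, 1::nat}. (- 1) ^ k * (if k = 0 then a i else b i))"
    by simp
  also have "\<dots> = (\<Sum>\<epsilon> \<in> (UNIV::'n set) \<rightarrow>\<^sub>E {0, 1::nat}.
      \<Prod>i\<in>UNIV. (- 1) ^ \<epsilon> i * (if \<epsilon> i = 0 then a i else b i))"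
    by (rule prod_sum_PiE) auto
  also have "(UNIV::'n set) \<rightarrow>\<^sub>E {0, 1::nat} = {\<epsilon>. \<forall>i. \<epsilon> i \<in> {0, 1}}"
    by (auto simp: PiE_UNIV_domain Pi_def)
  finally show ?thesis
    by (simp add: prod.distrib power_sum)
qed

lemma closed_box_between [simp]: "closed (box_between l u)"
  unfolding box_between_def Collect_conj_eq Collect_all_eq
  by (intro closed_INT ballI closed_Int closed_Collect_le continuous_intros
      continuous_on_compose2[OF continuous_on_ereal]) auto

text \<open>Both sides are iterated integrals of one nonnegative kernel, so Tonelli applies without
  prior integrability. The positive \<open>l j\<close> keeps the coordinate sum positive on the box,
  as the Gamma integral requires.\<close>

lemma nn_integral_box_between:
  fixes l :: "'n::finite \<Rightarrow> real" and u :: "'n \<Rightarrow> ereal"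
  assumes l: "\<And>i. 0 \<le> l i"
    and lu: "\<And>i. ereal (l i) \<le> u i"
    and j: "0 < l j"
  shows "(\<integral>\<^sup>+x. ennreal (indicator (box_between l u) x *
              (1 / (\<Sum>i\<in>UNIV. x $ i) ^ (CARD('n) + 1))) \<partial>(lborel :: (real ^ 'n) measure))
       = (\<integral>\<^sup>+t. ennreal (indicator {0<..} t * (1 / fact CARD('n) *
              (\<Prod>i\<in>UNIV. exp_decay t (ereal (l i)) - exp_decay t (u i)))) \<partial>lborel)"
proof -
  let ?N = "CARD('n)" and ?Q = "box_between l u"
  \<comment> \<open>The constant \<open>1 / fact ?N\<close> cancels the factorial coming from the
    Gamma integral.\<close>
  define K :: "real ^ 'n \<Rightarrow> real \<Rightarrow> ennreal" where
    "K = (\<lambda>x t. ennreal (1 / fact ?N) * indicator ?Q x *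
      (ennreal (t ^ ?N * exp (- ((\<Sum>i\<in>UNIV. x $ i) * t))) * indicator {0<..} t))"
  have [measurable]: "?Q \<in> sets borel"
    by (simp add: borel_closed)
  have inner: "(\<integral>\<^sup>+t. K x t \<partial>lborel)
      = ennreal (indicator ?Q x * (1 / (\<Sum>i\<in>UNIV. x $ i) ^ (?N + 1)))" for x
  proof (cases "x \<in> ?Q")
    case True
    then have x: "l i \<le> x $ i" for i
      by (auto simp: box_between_def)
    have "0 < (\<Sum>i\<in>UNIV. x $ i)"
      by (rule sum_pos2[where i = j]) (use x l j in \<open>auto intro: order_trans less_le_trans\<close>)
    from nn_integral_power_exp[OF this, of ?N] show ?thesis
      using True unfolding K_def
      by (subst nn_integral_cmult) (auto simp: ennreal_mult'[symmetric])
  qed (simp add: K_def)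
  have outer: "(\<integral>\<^sup>+x. K x t \<partial>lborel) = ennreal (indicator {0<..} t * (1 / fact ?N *
      (\<Prod>i\<in>UNIV. exp_decay t (ereal (l i)) - exp_decay t (u i))))" for t
  proof (cases "0 < t")
    case t: True
    let ?f = "\<lambda>i y. ennreal (exp (- (t * y))) * indicator {y. l i \<le> y \<and> ereal y \<le> u i} y"
    \<comment> \<open>For fixed \<open>t\<close> the kernel separates: the box indicator is the
      product of the interval indicators, and outside the box one of these vanishes.\<close>
    have "K x t = ennreal (t ^ ?N / fact ?N) * (\<Prod>i\<in>UNIV. ?f i (x $ i))" for x
    proof (cases "x \<in> ?Q")
      case True
      then have "(\<Prod>i\<in>UNIV. ?f i (x $ i)) = (\<Prod>i\<in>UNIV. ennreal (exp (- (t * x $ i))))"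
        by (intro prod.cong) (auto simp: box_between_def)
      also have "\<dots> = ennreal (exp (- ((\<Sum>i\<in>UNIV. x $ i) * t)))"
        by (simp add: prod_ennreal exp_sum[symmetric] sum_negf sum_distrib_left[symmetric] mult.commute)
      finally show ?thesis
        using True t by (simp add: K_def ennreal_mult'[symmetric])
    next
      case False
      then obtain i where "x $ i \<notin> {y. l i \<le> y \<and> ereal y \<le> u i}"
        by (auto simp: box_between_def)
      then have "(\<Prod>i\<in>UNIV. ?f i (x $ i)) = 0"
        by (intro prod_zero bexI[of _ i]) simp_all
      with False show ?thesis
        by (simp add: K_def)
    qed
    then have "(\<integral>\<^sup>+x. K x t \<partial>lborel)
        = (\<integral>\<^sup>+x. ennreal (t ^ ?N / fact ?N) * (\<Prod>i\<in>UNIV. ?f i (x $ i)) \<partial>lborel)"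
      by simp
    also have "\<dots> = ennreal (t ^ ?N / fact ?N) * (\<integral>\<^sup>+x. (\<Prod>i\<in>UNIV. ?f i (x $ i)) \<partial>lborel)"
      by (intro nn_integral_cmult) measurable
    also have "(\<integral>\<^sup>+x. (\<Prod>i\<in>UNIV. ?f i (x $ i)) \<partial>(lborel :: (real ^ 'n) measure))
        = (\<Prod>i\<in>UNIV. \<integral>\<^sup>+y. ?f i y \<partial>lborel)"
      by (intro nn_integral_lborel_prod_vec) measurable
    also have "\<dots> = (\<Prod>i\<in>UNIV. ennreal ((exp_decay t (ereal (l i)) - exp_decay t (u i)) / t))"
      using t lu by (simp only: nn_integral_exp_interval)
    \<comment> \<open>Pulling \<open>ennreal\<close> out of the product needs nonnegative factors;
      \<open>exp_decay t (ereal (l i))\<close> stays folded so that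
      \<open>exp_decay_antimono\<close> matches.\<close>
    also have "\<dots> = ennreal (\<Prod>i\<in>UNIV. (exp_decay t (ereal (l i)) - exp_decay t (u i)) / t)"
      using t lu by (intro prod_ennreal) (simp add: exp_decay_antimono del: exp_decay_ereal)
    \<comment> \<open>The \<open>?N\<close> factors \<open>1 / t\<close> cancel
      \<open>t ^ ?N\<close> exactly.\<close>
    also have "ennreal (t ^ ?N / fact ?N) * \<dots> = ennreal (1 / fact ?N *
        (\<Prod>i\<in>UNIV. exp_decay t (ereal (l i)) - exp_decay t (u i)))"
      using t by (simp add: ennreal_mult'[symmetric] prod_dividef)
    finally show ?thesis
      using t by simp
  qed (simp add: K_def)
  \<comment> \<open>Tonelli requires joint measurability of \<open>K\<close>; the coordinate sum
    enters as a continuous function of the first component.\<close>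
  have "(\<lambda>x :: real ^ 'n. \<Sum>i\<in>UNIV. x $ i) \<in> borel_measurable borel"
    by (intro borel_measurable_continuous_onI continuous_intros)
  then have [measurable]: "(\<lambda>p :: (real ^ 'n) \<times> real. \<Sum>i\<in>UNIV. fst p $ i) \<in> borel_measurable (borel \<Otimes>\<^sub>M borel)"
    by (rule measurable_compose[OF measurable_fst])
  have "case_prod K \<in> borel_measurable (borel \<Otimes>\<^sub>M borel)"
    unfolding K_def by measurable
  then have "case_prod K \<in> borel_measurable (lborel \<Otimes>\<^sub>M lborel)"
    by (simp cong: measurable_cong_sets sets_pair_measure_cong)
  from lborel_pair.Fubini'[OF this] show ?thesis
    by (simp only: inner outer)
qed

theorem mainTheorem6:
  fixes l :: "'n::finite \<Rightarrow> real" and u :: "'n \<Rightarrow> ereal"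
  assumes "\<And>i. 0 \<le> l i"
    and "\<And>i. ereal (l i) \<le> u i"
    and "0 \<notin> box_between l u"
  shows "set_integrable lborel (box_between l u)
           (\<lambda>x :: real ^ 'n. 1 / (\<Sum>i\<in>UNIV. x $ i) ^ (CARD('n) + 1))
       \<and> (LINT x : box_between l u | lborel. 1 / (\<Sum>i\<in>UNIV. x $ i) ^ (CARD('n) + 1))
         = 1 / fact CARD('n) *
           (\<Sum>\<epsilon> \<in> {\<epsilon> :: 'n \<Rightarrow> nat. \<forall>i. \<epsilon> i \<in> {0, 1}}.
              (- 1) ^ (\<Sum>i\<in>UNIV. \<epsilon> i) * inverse_coord_sum (corner l u \<epsilon>))"
proof -
  let ?Q = "box_between l u" and ?E = "{\<epsilon> :: 'n \<Rightarrow> nat. \<forall>i. \<epsilon> i \<in> {0, 1}}"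
  let ?f = "\<lambda>x :: real ^ 'n. indicator ?Q x * (1 / (\<Sum>i\<in>UNIV. x $ i) ^ (CARD('n) + 1))"
  let ?g = "\<lambda>t. indicator {0<..} t * (1 / fact CARD('n) *
      (\<Prod>i\<in>UNIV. exp_decay t (ereal (l i)) - exp_decay t (u i)))"
  define R where "R = 1 / fact CARD('n) *
    (\<Sum>\<epsilon>\<in>?E. (- 1) ^ (\<Sum>i\<in>UNIV. \<epsilon> i) * inverse_coord_sum (corner l u \<epsilon>))"
  have [measurable]: "?Q \<in> sets borel"
    by (simp add: borel_closed)
  have u: "0 \<le> u i" for i
    using assms(1)[of i] assms(2)[of i] by (metis ereal_less_eq(5) order_trans)
  \<comment> \<open>All upper bounds are nonnegative, so the origin can only be excluded by a
    positive lower bound.\<close>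
  obtain j where j: "0 < l j"
    using assms(1,3) u by (force simp: box_between_def not_le zero_ereal_def[symmetric])
  have corner: "has_bochner_integral lborel
      (\<lambda>t. indicator {0<..} t * (\<Prod>i\<in>UNIV. exp_decay t (corner l u \<epsilon> i)))
      (inverse_coord_sum (corner l u \<epsilon>))" for \<epsilon>
  proof (rule has_bochner_integral_prod_exp_decay)
    show "0 \<le> corner l u \<epsilon> i" for i
      using assms(1) u by (simp add: corner_def)
    \<comment> \<open>Both candidates for this coordinate, \<open>l j\<close> and
      \<open>u j\<close>, are positive, so no corner is the origin.\<close>
    have "0 < corner l u \<epsilon> j"
      using j less_le_trans[OF _ assms(2)[of j], of 0] by (simp add: corner_def)
    then show "\<exists>i. 0 < corner l u \<epsilon> i" ..
  qed
  have "has_bochner_integral lborel (\<lambda>t. 1 / fact CARD('n) * (\<Sum>\<epsilon>\<in>?E. (- 1) ^ (\<Sum>i\<in>UNIV. \<epsilon> i) *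
      (indicator {0<..} t * (\<Prod>i\<in>UNIV. exp_decay t (corner l u \<epsilon> i))))) R"
    unfolding R_def
    by (intro has_bochner_integral_mult_right has_bochner_integral_sum corner)
  \<comment> \<open>Choosing \<open>l i\<close> or \<open>u i\<close> inside
    \<open>exp_decay\<close> is the same as choosing between the two exponentials, so the sum over
    corners is the expanded product.\<close>
  moreover have "1 / fact CARD('n) * (\<Sum>\<epsilon>\<in>?E. (- 1) ^ (\<Sum>i\<in>UNIV. \<epsilon> i) *
      (indicator {0<..} t * (\<Prod>i\<in>UNIV. exp_decay t (corner l u \<epsilon> i)))) = ?g t" for t
    unfolding prod_diff_expand corner_def if_distrib[of "exp_decay t"]
    by (simp add: sum_distrib_left mult_ac)
  ultimately have g: "has_bochner_integral lborel ?g R"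
    by simp
  have g_nonneg: "0 \<le> ?g t" for t
    using assms(2) by (auto simp: indicator_def exp_decay_antimono simp del: exp_decay_ereal
        intro!: prod_nonneg divide_nonneg_nonneg)
  \<comment> \<open>The sign of the alternating sum is not visible from its terms; it is inherited
    from the nonnegative integrand \<open>?g\<close>.\<close>
  have R: "0 \<le> R"
    unfolding has_bochner_integral_integral_eq[OF g, symmetric]
    by (intro Bochner_Integration.integral_nonneg g_nonneg)
  have "(\<integral>\<^sup>+x. ennreal (?f x) \<partial>lborel) = (\<integral>\<^sup>+t. ennreal (?g t) \<partial>lborel)"
    using assms(1,2) j by (rule nn_integral_box_between)
  also have "\<dots> = ennreal R"
    unfolding has_bochner_integral_integral_eq[OF g, symmetric]
    by (intro nn_integral_eq_integral integrable.intros[OF g] always_eventually allI g_nonneg)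
  finally have nn: "(\<integral>\<^sup>+x. ennreal (?f x) \<partial>lborel) = ennreal R" .
  have "0 \<le> ?f x" for x
    using assms(1) by (auto simp: indicator_def box_between_def
        intro!: divide_nonneg_nonneg mult_nonneg_nonneg zero_le_power sum_nonneg intro: order_trans)
  \<comment> \<open>For a nonnegative measurable function, a finite nonnegative integral gives
    integrability and the value together.\<close>
  then have "has_bochner_integral lborel ?f R"
    using R nn by (intro has_bochner_integral_nn_integral) auto
  then show ?thesis
    by (simp add: has_bochner_integral_iff set_integrable_def set_lebesgue_integral_def R_def)
qed

end
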